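(* Let $\gamma\in[0,1]$ and $x\in\mathcal{X}$. If $\Lambda$ is a probability measure on $\mathcal{T}$, absolutely continuous with respect to $\nu_{\mathcal{T}}$ with density $\lambda$, and $\Psi_\Lambda^{-1}\circ\Psi_{\Pi_\Upsilon}\in\mathcal{D}_{\mathcal{T},\mathcal{T}}$, then $C_\gamma(x)\in[B_{\Lambda,\gamma}(x)]$, where $C_\gamma(x)$ is the $\gamma$-relative surprise region for $\tau=\Upsilon(\theta)$.
   Context: Setting: $\{f_\theta:\theta\in\Theta\}$ is a statistical model on the sample space $\mathcal{X}$ with probability measures $P_\theta$, and $\Pi$ is a proper prior (a probability measure) on $\Theta$. The parameter of interest is $\tau=\Upsilon(\theta)\in\mathcal{T}$, where $\mathcal{T}$ is an open subset of $R^k$ and $\nu_{\mathcal{T}}$ is volume measure on $\mathcal{T}$. $\Pi_\Upsilon$ and $\Pi_\Upsilon(\cdot\mid x)$ are the marginal prior and posterior (given $X=x$) distributions of $\tau$, with densities $\pi_\Upsilon$ and $\pi_\Upsilon(\cdot\mid x)$ with respect to $\nu_{\mathcal{T}}$. $\mathcal{D}_{\mathcal{T},\mathcal{T}}$ is the class of maps $\Psi:\mathcal{T}\to\mathcal{T}$ that are 1-1, onto, continuously differentiable and such that $\Psi^{-1}$ is continuously differentiable. $J_\Psi(\tau)$ is the (absolute) Jacobian determinant of $\Psi$ at $\tau$, and $J_\Psi^{-1}(\tau)=1/J_\Psi(\tau)$. For a probability measure $\Lambda$ on $\mathcal{T}$, $\Psi_\Lambda:\mathcal{T}\to[0,1]^k$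 denotes a (chosen) map such that $\Psi_\Lambda(\tau)\sim\mathrm{Uniform}([0,1]^k)$ when $\tau\sim\Lambda$ (e.g. the probability transform), and $\Psi_\Lambda^{-1}$ is its inverse map; $\Psi_{\Pi_\Upsilon}$ is such a map for $\Pi_\Upsilon$. For $\Psi\in\mathcal{D}_{\mathcal{T},\mathcal{T}}$ let $$B^{\Psi}_{\Lambda,\gamma}(x)=\left\{\psi_0\in\mathcal{T}:\Pi_\Upsilon\left(\left\{\tau:\frac{\pi_\Upsilon(\tau\mid x)J_\Psi^{-1}(\tau)}{\lambda(\Psi(\tau))}>\frac{\pi_\Upsilon(\Psi^{-1}(\psi_0)\mid x)J_\Psi^{-1}(\Psi^{-1}(\psi_0))}{\lambda(\psi_0)}\right\}\,\Big|\,x\right)\le\gamma\right\},$$ and $[B_{\Lambda,\gamma}(x)]=\{\Psi^{-1}B^{\Psi}_{\Lambda,\gamma}(x):\Psi\in\mathcal{D}_{\mathcal{T},\mathcal{T}}\}$. The $\gamma$-relative surprise region is $$C_\gamma(x)=\left\{\tau_0\in\mathcal{T}:\Pi_\Upsilon\left(\left\{\tau:\frac{\pi_\Upsilon(\tau\mid x)}{\pi_\Upsilon(\tau)}>\frac{\pi_\Upsilon(\tau_0\mid x)}{\pi_\Upsilon(\tau_0)}\right\}\,\Big|\,x\right)\le\gamma\right\}.$$ Regions are identified up to the $\nu_{\mathcal{T}}$-null ambiguity coming from the choice of version of densities. *)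

theory Defs
  imports "HOL-Probability.Probability"
begin

text \<open>
  A statistical model with sampling densities \<open>f \<theta>\<close> relative to a support measure \<open>M\<close> on the
  sample space, together with a proper prior \<open>Pr\<close> on the parameter space \<open>space Pr\<close>.
\<close>

definition bayesian_model :: "'x measure \<Rightarrow> ('t \<Rightarrow> 'x \<Rightarrow> real) \<Rightarrow> 't measure \<Rightarrow> bool" where
  "bayesian_model M f Pr \<longleftrightarrow>
     sigma_finite_measure M \<and> prob_space Pr \<and>
     (\<lambda>(\<theta>, x). f \<theta> x) \<in> borel_measurable (Pr \<Otimes>\<^sub>M M) \<and>
     (\<forall>\<theta>\<in>space Pr. (\<forall>x\<in>space M. 0 \<le> f \<theta> x) \<and>
        prob_space (density M (\<lambda>x. ennreal (f \<theta> x))))"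

text \<open>
  Bayes' formula. If the prior predictive density \<open>\<integral>\<^sup>+\<theta>. f \<theta> x \<partial>Pr\<close> is 0 or \<open>\<infinity>\<close>, this is
  the null measure instead of a probability measure.
\<close>

definition posterior :: "('t \<Rightarrow> 'x \<Rightarrow> real) \<Rightarrow> 't measure \<Rightarrow> 'x \<Rightarrow> 't measure" where
  "posterior f Pr x =
     density Pr (\<lambda>\<theta>. ennreal (f \<theta> x) / (\<integral>\<^sup>+\<theta>'. ennreal (f \<theta>' x) \<partial>Pr))"

definition volume_on :: "(real^'k) set \<Rightarrow> (real^'k) measure" where
  "volume_on T = restrict_space lborel T"

definition marginal_on :: "(real^'k) set \<Rightarrow> ('t \<Rightarrow> real^'k) \<Rightarrow> 't measure \<Rightarrow> (real^'k) measure" where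
  "marginal_on T Ups P = distr P (restrict_space borel T) Ups"

definition is_density :: "'a measure \<Rightarrow> 'a measure \<Rightarrow> ('a \<Rightarrow> real) \<Rightarrow> bool" where
  "is_density N P p \<longleftrightarrow>
     p \<in> borel_measurable N \<and> (\<forall>y\<in>space N. 0 \<le> p y) \<and> P = density N (\<lambda>y. ennreal (p y))"

text \<open>For open \<open>T\<close> these notions depend only on the values of the maps on \<open>T\<close>.\<close>

definition continuously_differentiable_on ::
    "(real^'k \<Rightarrow> real^'k) \<Rightarrow> (real^'k) set \<Rightarrow> bool" where
  "continuously_differentiable_on g T \<longleftrightarrow>
     (\<forall>\<tau>\<in>T. g differentiable (at \<tau>)) \<and> continuous_on T (\<lambda>\<tau>. jacobian g (at \<tau>))"

definition diffeos :: "(real^'k) set \<Rightarrow> (real^'k \<Rightarrow> real^'k) set" where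
  "diffeos T = {\<Psi>. bij_betw \<Psi> T T \<and> continuously_differentiable_on \<Psi> T \<and>
                    continuously_differentiable_on (inv_into T \<Psi>) T}"

definition abs_jac :: "(real^'k \<Rightarrow> real^'k) \<Rightarrow> real^'k \<Rightarrow> real" where
  "abs_jac \<Psi> \<tau> = \<bar>det (jacobian \<Psi> (at \<tau>))\<bar>"

text \<open>
  The inverse of a uniformizing map \<open>u\<close> is \<open>inv_into T u\<close>. Injectivity is not part of this
  definition; if \<open>inv_into T u \<circ> v\<close> maps \<open>T\<close> bijectively onto itself, then \<open>u\<close> is injective
  on \<open>T\<close> up to at most one point.
\<close>

definition uniformizing ::
    "(real^'k) set \<Rightarrow> (real^'k) measure \<Rightarrow> (real^'k \<Rightarrow> real^'k) \<Rightarrow> bool" where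
  "uniformizing T P u \<longleftrightarrow>
     u \<in> T \<rightarrow> cbox 0 1 \<and> u \<in> borel_measurable P \<and>
     distr P borel u = uniform_measure lborel (cbox 0 1)"

text \<open>
  In the regions below, \<open>Q\<close> is the marginal posterior, \<open>q\<close> its density, \<open>p\<close> the marginal prior
  density and \<open>l\<close> the density of \<open>\<Lambda>\<close>. Ratios of densities are formed in \<open>ennreal\<close>, so that a
  positive number divided by 0 is \<open>\<infinity>\<close>, while 0 divided by 0 is 0.
\<close>

definition relative_surprise_region ::
    "(real^'k) set \<Rightarrow> (real^'k) measure \<Rightarrow> (real^'k \<Rightarrow> real) \<Rightarrow> (real^'k \<Rightarrow> real) \<Rightarrow> real
      \<Rightarrow> (real^'k) set" where
  "relative_surprise_region T Q q p \<gamma> =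
     {\<tau>0 \<in> T. measure Q {\<tau> \<in> T. ennreal (q \<tau>) / ennreal (p \<tau>)
                              > ennreal (q \<tau>0) / ennreal (p \<tau>0)} \<le> \<gamma>}"

definition B_region ::
    "(real^'k) set \<Rightarrow> (real^'k) measure \<Rightarrow> (real^'k \<Rightarrow> real) \<Rightarrow> (real^'k \<Rightarrow> real) \<Rightarrow> real
      \<Rightarrow> (real^'k \<Rightarrow> real^'k) \<Rightarrow> (real^'k) set" where
  "B_region T Q q l \<gamma> \<Psi> =
     {\<psi>0 \<in> T. measure Q {\<tau> \<in> T.
          ennreal (q \<tau> * (1 / abs_jac \<Psi> \<tau>)) / ennreal (l (\<Psi> \<tau>))
        > ennreal (q (inv_into T \<Psi> \<psi>0) * (1 / abs_jac \<Psi> (inv_into T \<Psi> \<psi>0)))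
            / ennreal (l \<psi>0)} \<le> \<gamma>}"

definition B_class ::
    "(real^'k) set \<Rightarrow> (real^'k) measure \<Rightarrow> (real^'k \<Rightarrow> real) \<Rightarrow> (real^'k \<Rightarrow> real) \<Rightarrow> real
      \<Rightarrow> (real^'k) set set" where
  "B_class T Q q l \<gamma> = {\<Psi> -` B_region T Q q l \<gamma> \<Psi> \<inter> T | \<Psi>. \<Psi> \<in> diffeos T}"

text \<open>Membership of a region in a class of regions, regions being identified modulo null sets.\<close>

definition mem_mod_null :: "'a measure \<Rightarrow> 'a set \<Rightarrow> 'a set set \<Rightarrow> bool" where
  "mem_mod_null N C \<B> \<longleftrightarrow> (\<exists>R\<in>\<B>. AE y in N. y \<in> C \<longleftrightarrow> y \<in> R)"

end

theory Submission
  imports Defs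
begin

text \<open>
  Take \<open>\<Psi> = \<Psi>\<^sub>\<Lambda>\<^sup>-\<^sup>1 \<circ> \<Psi>\<^sub>\<Pi>\<close>. It transports the marginal prior to \<open>\<Lambda>\<close>, so the change of variables formula
  gives \<open>\<pi> = J\<^sub>\<Psi> \<cdot> (\<lambda> \<circ> \<Psi>)\<close> almost everywhere. Hence the ratio defining \<open>B\<^sup>\<Psi>\<close> at \<open>\<Psi> \<tau>\<close> is almost
  everywhere the ratio \<open>\<pi>(\<tau> | x) / \<pi>(\<tau>)\<close> defining the relative surprise region.

  The transport property rests on the fact that a finite Borel measure is determined by its image
  under an injective Borel map. By Lusin's theorem the map is continuous on compact sets of almost
  full measure, where it sends compact sets to compact sets; hence the measure of a compact subset
  is recovered from the image measure.
\<close>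

section \<open>Inner regularity and Lusin's theorem on Polish spaces\<close>

lemma compact_inner_approx:
  fixes P :: "'a::polish_space measure"
  assumes "sets P = sets borel" "finite_measure P" "A \<in> sets borel" "0 < (e::real)"
  obtains K where "compact K" "K \<subseteq> A" "emeasure P (A - K) \<le> ennreal e"
proof -
  interpret finite_measure P by fact
  have "emeasure P A = (SUP K \<in> {K. K \<subseteq> A \<and> compact K}. emeasure P K)"
    by (rule inner_regular) (use assms in auto)
  then have "(SUP K \<in> {K. K \<subseteq> A \<and> compact K}. emeasure P K) = measure P A"
    by (simp add: emeasure_eq_measure)
  then have "\<exists>K\<in>{K. K \<subseteq> A \<and> compact K}. measure P A < emeasure P K + e"
    by (intro SUP_approx_ennreal) (use assms in auto)
  then obtain K where K: "compact K" "K \<subseteq> A" "measure P A < emeasure P K + e"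
    by auto
  have [measurable]: "K \<in> sets P" "A \<in> sets P"
    using K assms by (auto simp: borel_compact)
  have "measure P A < measure P K + e"
    using K(3) \<open>0 < e\<close> by (simp add: emeasure_eq_measure ennreal_less_iff flip: ennreal_plus)
  then have "measure P (A - K) \<le> e"
    using K(2) by (subst finite_measure_Diff) auto
  then show ?thesis
    using K that by (simp add: emeasure_eq_measure ennreal_leI)
qed

text \<open>Approximate the preimages of the basic open sets \<open>V n\<close> and of their
  complements from inside by compact sets \<open>C n\<close> and \<open>D n\<close>. On the
  intersection \<open>K\<close> of the unions \<open>C n \<union> D n\<close>, the preimage of
  \<open>V n\<close> is \<open>K - D n\<close>, which is relatively open.\<close>

lemma Lusin_compact:
  fixes P :: "'a::polish_space measure" and u :: "'a \<Rightarrow> 'b::second_countable_topology"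
  assumes P: "sets P = sets borel" "finite_measure P" and S: "S \<in> sets borel"
    and u: "u \<in> borel_measurable (restrict_space borel S)" and e: "0 < (e::real)"
  obtains K where "compact K" "K \<subseteq> S" "continuous_on K u" "emeasure P (S - K) \<le> ennreal e"
proof -
  interpret finite_measure P by fact
  obtain \<B> :: "'b set set" where \<B>: "countable \<B>" "topological_basis \<B>"
    using ex_countable_basis by blast
  have ne: "\<B> \<noteq> {}"
    using topological_basisE[OF \<B>(2) open_UNIV UNIV_I] by blast
  define V where "V = from_nat_into \<B>"
  have V_in: "V n \<in> \<B>" for n
    unfolding V_def by (rule from_nat_into) fact
  have V_open: "open (V n)" for n
    using V_in \<B>(2) topological_basis_open by blast
  define A where "A n = u -` V n \<inter> S" for n
  define A' where "A' n = u -` (- V n) \<inter> S" for n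
  have meas: "u -` W \<inter> S \<in> sets borel" if "W \<in> sets borel" for W
  proof -
    have "u -` W \<inter> S \<in> sets (restrict_space borel S)"
      using measurable_sets[OF u that] by (simp add: space_restrict_space)
    then show ?thesis
      using S by (simp add: sets_restrict_space_iff)
  qed
  have AB: "A n \<in> sets borel" "A' n \<in> sets borel" for n
    unfolding A_def A'_def using V_open[of n] by (auto intro!: meas)
  \<comment> \<open>Each \<open>n\<close> contributes two gaps of size at most \<open>d n\<close>;
    over all \<open>n\<close> these bounds add up to exactly \<open>e\<close>.\<close>
  define d where "d n = e * (1/2) ^ Suc n / 2" for n
  have d: "0 < d n" for n
    unfolding d_def using e by simp
  have "\<exists>C. compact C \<and> C \<subseteq> A n \<and> emeasure P (A n - C) \<le> ennreal (d n)" for n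
    by (rule compact_inner_approx[OF P AB(1)[of n] d[of n]]) auto
  then obtain C where C: "\<And>n. compact (C n)" "\<And>n. C n \<subseteq> A n"
      "\<And>n. emeasure P (A n - C n) \<le> ennreal (d n)"
    by metis
  have "\<exists>C. compact C \<and> C \<subseteq> A' n \<and> emeasure P (A' n - C) \<le> ennreal (d n)" for n
    by (rule compact_inner_approx[OF P AB(2)[of n] d[of n]]) auto
  then obtain D where D: "\<And>n. compact (D n)" "\<And>n. D n \<subseteq> A' n"
      "\<And>n. emeasure P (A' n - D n) \<le> ennreal (d n)"
    by metis
  define K where "K = (\<Inter>n. C n \<union> D n)"
  have compact: "compact K"
  proof -
    \<comment> \<open>Intersections of closed sets are only closed in general, so one compact member
      of the family is split off.\<close>
    have "compact ((C 0 \<union> D 0) \<inter> K)"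
      unfolding K_def using C(1) D(1)
      by (intro compact_Int_closed closed_INT compact_Un ballI) (auto intro: compact_imp_closed)
    also have "(C 0 \<union> D 0) \<inter> K = K"
      unfolding K_def by auto
    finally show ?thesis .
  qed
  have sub: "K \<subseteq> S"
    unfolding K_def using C(2)[of 0] D(2)[of 0] by (auto simp: A_def A'_def)
  have cont: "continuous_on K u"
    unfolding continuous_on_topological
  proof (intro ballI allI impI)
    fix x W assume x: "x \<in> K" and W: "open W" "u x \<in> W"
    obtain B where B: "B \<in> \<B>" "u x \<in> B" "B \<subseteq> W"
      using topological_basisE[OF \<B>(2) W] by blast
    obtain n where n: "B = V n"
      unfolding V_def using from_nat_into_surj[OF \<B>(1) B(1)] by metis
    show "\<exists>O'. open O' \<and> x \<in> O' \<and> (\<forall>y\<in>K. y \<in> O' \<longrightarrow> u y \<in> W)"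
    proof (intro exI[of _ "- D n"] conjI ballI impI)
      show "open (- D n)"
        using D(1)[of n] by (simp add: compact_imp_closed open_Compl)
      show "x \<in> - D n"
        using B n D(2)[of n] by (auto simp: A'_def)
      fix y assume "y \<in> K" "y \<in> - D n"
      then have "y \<in> C n"
        unfolding K_def by auto
      then show "u y \<in> W"
        using C(2)[of n] B n by (auto simp: A_def)
    qed
  qed
  have gap_sets: "(A n - C n) \<union> (A' n - D n) \<in> sets P" for n
    unfolding P(1) by (intro sets.Un sets.Diff AB borel_compact C D)
  then have gaps: "range (\<lambda>n. (A n - C n) \<union> (A' n - D n)) \<subseteq> sets P"
    by blast
  have step: "emeasure P ((A n - C n) \<union> (A' n - D n)) \<le> ennreal (e * (1/2) ^ Suc n)" for n
  proof -
    have "emeasure P ((A n - C n) \<union> (A' n - D n))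
        \<le> emeasure P (A n - C n) + emeasure P (A' n - D n)"
      by (rule emeasure_subadditive) (use AB C(1) D(1) P in \<open>auto simp: borel_compact\<close>)
    also have "\<dots> \<le> ennreal (d n) + ennreal (d n)"
      by (intro add_mono C D)
    also have "\<dots> = ennreal (e * (1/2) ^ Suc n)"
      using d[of n] by (simp add: d_def flip: ennreal_plus)
    finally show ?thesis .
  qed
  \<comment> \<open>\<open>A n\<close> and \<open>A' n\<close> partition \<open>S\<close>, so a
    point of \<open>S\<close> missed by \<open>C n \<union> D n\<close> lies in the gap with index
    \<open>n\<close>.\<close>
  have "S - K \<subseteq> (\<Union>n. (A n - C n) \<union> (A' n - D n))"
    unfolding K_def A_def A'_def by auto
  then have "emeasure P (S - K) \<le> emeasure P (\<Union>n. (A n - C n) \<union> (A' n - D n))"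
    by (intro emeasure_mono sets.countable_UN gaps)
  also have "\<dots> \<le> (\<Sum>n. emeasure P ((A n - C n) \<union> (A' n - D n)))"
    by (intro emeasure_subadditive_countably gaps)
  also have "\<dots> \<le> (\<Sum>n. ennreal (e * (1/2) ^ Suc n))"
    by (rule suminf_le[OF step summableI summableI])
  also have "\<dots> = ennreal e"
  proof (rule suminf_ennreal_eq)
    show "0 \<le> e * (1/2) ^ Suc n" for n
      using e by simp
    show "(\<lambda>n. e * (1/2) ^ Suc n) sums e"
      using sums_mult[OF power_half_series, of e] by simp
  qed
  finally show ?thesis
    using that compact sub cont by blast
qed

section \<open>Finite measures determined by their image under an injective map\<close>

text \<open>A compact \<open>C \<subseteq> A\<close> on which \<open>u\<close> is continuous has a
  compact, hence Borel, image, and injectivity makes \<open>C\<close> the full preimage of that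
  image in \<open>S\<close>; so \<open>eq\<close> applies to \<open>C\<close>. Approximating from
  inside with respect to \<open>P\<close> alone gives one inequality; exchanging \<open>P\<close>
  and \<open>Q\<close> gives the other.\<close>

lemma emeasure_le_of_injective_image:
  fixes P Q :: "'a::polish_space measure"
    and u :: "'a \<Rightarrow> 'b::{second_countable_topology, t2_space}"
  assumes P: "sets P = sets borel" "finite_measure P" and Q: "sets Q = sets borel"
    and S: "S \<in> sets borel" "emeasure P (- S) = 0"
    and u: "u \<in> borel_measurable (restrict_space borel S)" "inj_on u S"
    and eq: "\<And>B. B \<in> sets borel \<Longrightarrow> emeasure P (u -` B \<inter> S) = emeasure Q (u -` B \<inter> S)"
    and A: "A \<in> sets borel"
  shows "emeasure P A \<le> emeasure Q A"
proof (rule ennreal_le_epsilon)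
  fix e :: real assume "0 < e"
  then have e: "0 < e / 2" by simp
  obtain K where K: "compact K" "K \<subseteq> S" "continuous_on K u" "emeasure P (S - K) \<le> ennreal (e/2)"
    using Lusin_compact[OF P S(1) u(1) e] .
  have AK: "A \<inter> K \<in> sets borel"
    using A borel_compact[OF K(1)] by (rule sets.Int)
  obtain C where C: "compact C" "C \<subseteq> A \<inter> K" "emeasure P (A \<inter> K - C) \<le> ennreal (e/2)"
    using compact_inner_approx[OF P AK e] .
  have [measurable]: "A \<in> sets P" "K \<in> sets P" "C \<in> sets P" "S \<in> sets P" "- S \<in> sets P"
      "A \<in> sets Q"
    unfolding P(1) Q using A S borel_compact[OF K(1)] borel_compact[OF C(1)] by simp_all
  have "compact (u ` C)"
    using C K by (intro compact_continuous_image continuous_on_subset[OF K(3)]) auto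
  then have "emeasure P (u -` (u ` C) \<inter> S) = emeasure Q (u -` (u ` C) \<inter> S)"
    by (intro eq) (simp add: borel_compact)
  also have "u -` (u ` C) \<inter> S = C"
    using u(2) C(2) K(2) by (auto dest: inj_onD)
  finally have PQ: "emeasure P C = emeasure Q C" .
  have sub2: "emeasure P (X \<union> Y) \<le> x + y"
    if "emeasure P X \<le> x" "emeasure P Y \<le> y" "X \<in> sets P" "Y \<in> sets P" for X Y x y
    using emeasure_subadditive[OF that(3,4)] add_mono[OF that(1,2)] by (rule order_trans)
  \<comment> \<open>\<open>A\<close> is covered by \<open>C\<close>, the rest of
    \<open>A \<inter> K\<close>, the rest of \<open>S\<close>, and the complement of
    \<open>S\<close>. The last three cost at most \<open>e/2\<close>, \<open>e/2\<close> and
    0.\<close>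
  have "emeasure P A \<le> emeasure P (C \<union> ((A \<inter> K - C) \<union> ((S - K) \<union> - S)))"
    by (rule emeasure_mono) auto
  also have "\<dots> \<le> emeasure P C + (emeasure P (A \<inter> K - C) + (emeasure P (S - K) + emeasure P (- S)))"
    by (intro sub2 order_refl) auto
  also have "\<dots> \<le> emeasure Q A + (ennreal (e/2) + (ennreal (e/2) + 0))"
    using C K S unfolding PQ by (intro add_mono emeasure_mono) auto
  also have "\<dots> = emeasure Q A + ennreal e"
    using \<open>0 < e\<close> by (simp flip: ennreal_plus)
  finally show "emeasure P A \<le> emeasure Q A + ennreal e" .
qed

lemma measure_eqI_injective_image:
  fixes P Q :: "'a::polish_space measure"
    and u :: "'a \<Rightarrow> 'b::{second_countable_topology, t2_space}"
  assumes P: "sets P = sets borel" "finite_measure P"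
    and Q: "sets Q = sets borel" "finite_measure Q"
    and S: "S \<in> sets borel" and PS: "emeasure P (- S) = 0" and QS: "emeasure Q (- S) = 0"
    and u: "u \<in> borel_measurable (restrict_space borel S)" "inj_on u S"
    and eq: "\<And>B. B \<in> sets borel \<Longrightarrow> emeasure P (u -` B \<inter> S) = emeasure Q (u -` B \<inter> S)"
  shows "P = Q"
proof (rule measure_eqI)
  show "sets P = sets Q" using P Q by simp
  fix A assume "A \<in> sets P"
  then have A: "A \<in> sets borel" by (simp add: P)
  show "emeasure P A = emeasure Q A"
    using emeasure_le_of_injective_image[OF P Q(1) S PS u eq A]
      emeasure_le_of_injective_image[OF Q P(1) S QS u eq[symmetric] A]
    by (rule antisym)
qed

section \<open>Transport of one measure to another through a common image\<close>

text \<open>Wherever \<open>\<Psi> = inv_into T u \<circ> v\<close> avoids one point,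
  \<open>u (\<Psi> \<tau>) = v \<tau>\<close>, so by \<open>eq\<close> both sides have the same
  image under \<open>u\<close>. Surjectivity of \<open>\<Psi>\<close> makes \<open>u\<close>
  injective off that point, and the absence of point masses makes the point negligible. On the
  right, the identity map only extends \<open>L\<close> from the trace sigma-algebra on
  \<open>T\<close> to all Borel sets.\<close>

lemma distr_inv_into_eq:
  fixes u v :: "'a::polish_space \<Rightarrow> 'b::{second_countable_topology, t2_space}"
  assumes T: "T \<in> sets borel"
    and P: "prob_space P" "sets P = sets (restrict_space borel T)" "\<And>a. AE \<tau> in P. \<tau> \<noteq> a"
    and L: "prob_space L" "sets L = sets (restrict_space borel T)" "\<And>a. AE \<tau> in L. \<tau> \<noteq> a"
    and uv [measurable]: "u \<in> borel_measurable L" "v \<in> borel_measurable P"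
    and eq: "distr P borel v = distr L borel u"
    and bij: "bij_betw (inv_into T u \<circ> v) T T"
    and meas: "inv_into T u \<circ> v \<in> borel_measurable (restrict_space borel T)"
  shows "distr P borel (inv_into T u \<circ> v) = distr L borel (\<lambda>\<tau>. \<tau>)"
proof -
  define \<Psi> where "\<Psi> = inv_into T u \<circ> v"
  \<comment> \<open>The junk value of \<open>inv_into T u\<close> outside \<open>u ` T\<close>. Since \<open>\<Psi>\<close> is onto \<open>T\<close>, this is the only point
    at which injectivity of \<open>u\<close> can fail.\<close>
  define c :: 'a where "c = (SOME y. False)"
  have inj: "inj_on \<Psi> T" and surj: "\<Psi> ` T = T"
    using bij by (simp_all add: \<Psi>_def bij_betw_def)
  have \<Psi>_T: "\<Psi> \<tau> \<in> T" if "\<tau> \<in> T" for \<tau>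
    using surj that by blast
  \<comment> \<open>\<open>inv_into T u\<close> is a Hilbert choice. At a value that
    \<open>u\<close> does not take on \<open>T\<close> its predicate is constantly false, so the
    choice is always the same point.\<close>
  have outside: "\<Psi> \<tau> = c" if "v \<tau> \<notin> u ` T" for \<tau>
  proof -
    have "(\<lambda>y. y \<in> T \<and> u y = v \<tau>) = (\<lambda>y. False)"
      using that by (auto simp: fun_eq_iff image_iff)
    then show ?thesis
      by (simp add: \<Psi>_def inv_into_def c_def)
  qed
  have u\<Psi>: "u (\<Psi> \<tau>) = v \<tau>" if "\<Psi> \<tau> \<noteq> c" for \<tau>
  proof -
    have "v \<tau> \<in> u ` T"
      using outside that by blast
    then show ?thesis
      by (simp add: \<Psi>_def f_inv_into_f)
  qed
  \<comment> \<open>Surjectivity writes \<open>t\<close> as \<open>\<Psi> \<tau>\<close>; then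
    \<open>u t = v \<tau>\<close>, and \<open>inv_into T u\<close> sends this value to
    \<open>\<Psi> \<tau>\<close>, which is \<open>t\<close>.\<close>
  have left_inv: "inv_into T u (u t) = t" if t: "t \<in> T - {c}" for t
  proof -
    obtain \<tau> where \<tau>: "\<tau> \<in> T" "t = \<Psi> \<tau>"
      using surj t by blast
    then have "u t = v \<tau>"
      using u\<Psi> t by auto
    then show ?thesis
      using \<tau> by (simp add: \<Psi>_def)
  qed
  have sP: "sets P = sets (restrict_space borel T)" "space P = T"
    using P(2) sets_eq_imp_space_eq[OF P(2)] by (simp_all add: space_restrict_space)
  have sL: "sets L = sets (restrict_space borel T)" "space L = T"
    using L(2) sets_eq_imp_space_eq[OF L(2)] by (simp_all add: space_restrict_space)
  have [measurable]: "\<Psi> \<in> borel_measurable P"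
    using meas by (simp add: \<Psi>_def measurable_cong_sets[OF sP(1) refl])
  have id [measurable]: "(\<lambda>\<tau>. \<tau>) \<in> borel_measurable L"
    by (simp add: measurable_cong_sets[OF sL(1) refl] measurable_restrict_space1)
  interpret P: prob_space P by fact
  interpret L: prob_space L by fact
  define S where "S = T - {c}"
  have S: "S \<in> sets borel"
    using T by (auto simp: S_def)
  have uS: "u -` B \<inter> S \<in> sets borel" if "B \<in> sets borel" for B
  proof -
    have "u -` B \<inter> T \<in> sets L"
      using measurable_sets[OF _ that, of u L] sL by simp
    then have "u -` B \<inter> T \<in> sets borel"
      using T by (simp add: sL sets_restrict_space_iff)
    then have "(u -` B \<inter> T) - {c} \<in> sets borel"
      by auto
    then show ?thesis
      by (simp add: S_def Int_Diff)
  qed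
  \<comment> \<open>\<open>\<Psi>\<close> is injective on \<open>T\<close>, so it takes the value
    \<open>c\<close> at most once there, and single points are null for \<open>P\<close>.\<close>
  have AE_P: "AE \<tau> in P. \<Psi> \<tau> \<noteq> c"
  proof (cases "c \<in> T")
    case True
    then obtain \<tau>0 where "\<tau>0 \<in> T" "\<Psi> \<tau>0 = c"
      using surj by (metis imageE)
    then have *: "\<Psi> \<tau> \<noteq> c" if "\<tau> \<in> T" "\<tau> \<noteq> \<tau>0" for \<tau>
      using inj that by (metis inj_onD)
    show ?thesis
      using P(3)[of \<tau>0] AE_space by eventually_elim (use * sP in auto)
  next
    case False
    then show ?thesis
      using \<Psi>_T sP by (intro AE_I2) auto
  qed
  have "distr P borel \<Psi> = distr L borel (\<lambda>\<tau>. \<tau>)"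
  proof (rule measure_eqI_injective_image[where u = u and S = S])
    show "finite_measure (distr P borel \<Psi>)" "finite_measure (distr L borel (\<lambda>\<tau>. \<tau>))"
      by (auto intro!: prob_space.finite_measure P.prob_space_distr L.prob_space_distr)
    show "emeasure (distr P borel \<Psi>) (- S) = 0"
    proof -
      have "emeasure P (\<Psi> -` (- S) \<inter> space P) = emeasure P {}"
      proof (rule emeasure_eq_AE)
        show "AE \<tau> in P. \<tau> \<in> \<Psi> -` (- S) \<inter> space P \<longleftrightarrow> \<tau> \<in> {}"
          using AE_P AE_space by eventually_elim (use \<Psi>_T sP in \<open>auto simp: S_def\<close>)
        show "\<Psi> -` (- S) \<inter> space P \<in> sets P"
          using S by (intro measurable_sets[of \<Psi> P borel]) auto
      qed simp
      then show ?thesis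
        using S by (simp add: emeasure_distr)
    qed
    show "emeasure (distr L borel (\<lambda>\<tau>. \<tau>)) (- S) = 0"
    proof -
      have "emeasure L ((\<lambda>\<tau>. \<tau>) -` (- S) \<inter> space L) = emeasure L {}"
      proof (rule emeasure_eq_AE)
        show "AE \<tau> in L. \<tau> \<in> (\<lambda>\<tau>. \<tau>) -` (- S) \<inter> space L \<longleftrightarrow> \<tau> \<in> {}"
          using L(3)[of c] AE_space by eventually_elim (use sL in \<open>auto simp: S_def\<close>)
        show "(\<lambda>\<tau>. \<tau>) -` (- S) \<inter> space L \<in> sets L"
          using S by (intro measurable_sets[OF id]) auto
      qed simp
      then show ?thesis
        using S by (simp add: emeasure_distr)
    qed
    show "u \<in> borel_measurable (restrict_space borel S)"
      using uS S by (intro measurableI) (auto simp: space_restrict_space sets_restrict_space_iff)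
    show "inj_on u S"
      using left_inv unfolding S_def by (rule inj_on_inverseI)
    fix B :: "'b set" assume B [measurable]: "B \<in> sets borel"
    have "emeasure (distr P borel \<Psi>) (u -` B \<inter> S) = emeasure P (\<Psi> -` (u -` B \<inter> S) \<inter> space P)"
      using uS[OF B] by (simp add: emeasure_distr)
    also have "\<dots> = emeasure P (v -` B \<inter> space P)"
    proof (rule emeasure_eq_AE)
      show "AE \<tau> in P. \<tau> \<in> \<Psi> -` (u -` B \<inter> S) \<inter> space P \<longleftrightarrow> \<tau> \<in> v -` B \<inter> space P"
        using AE_P AE_space by eventually_elim (use u\<Psi> \<Psi>_T sP in \<open>auto simp: S_def\<close>)
      show "\<Psi> -` (u -` B \<inter> S) \<inter> space P \<in> sets P"
        using uS[OF B] by (rule measurable_sets[rotated]) simp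
      show "v -` B \<inter> space P \<in> sets P" by simp
    qed
    also have "\<dots> = emeasure L (u -` B \<inter> space L)"
      using arg_cong[OF eq, of "\<lambda>M. emeasure M B"] by (simp add: emeasure_distr)
    \<comment> \<open>Passing from \<open>T\<close> to \<open>S\<close> removes at most the point
      \<open>c\<close>, which is null for \<open>L\<close>.\<close>
    also have "\<dots> = emeasure L ((\<lambda>\<tau>. \<tau>) -` (u -` B \<inter> S) \<inter> space L)"
    proof (rule emeasure_eq_AE)
      show "AE \<tau> in L. \<tau> \<in> u -` B \<inter> space L \<longleftrightarrow> \<tau> \<in> (\<lambda>\<tau>. \<tau>) -` (u -` B \<inter> S) \<inter> space L"
        using L(3)[of c] AE_space by eventually_elim (use sL in \<open>auto simp: S_def\<close>)
      show "(\<lambda>\<tau>. \<tau>) -` (u -` B \<inter> S) \<inter> space L \<in> sets L"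
        using uS[OF B] by (rule measurable_sets[OF id])
      show "u -` B \<inter> space L \<in> sets L" by simp
    qed
    also have "\<dots> = emeasure (distr L borel (\<lambda>\<tau>. \<tau>)) (u -` B \<inter> S)"
      using uS[OF B] by (simp add: emeasure_distr)
    finally show "emeasure (distr P borel \<Psi>) (u -` B \<inter> S)
        = emeasure (distr L borel (\<lambda>\<tau>. \<tau>)) (u -` B \<inter> S)" .
  qed (use S in auto)
  then show ?thesis
    unfolding \<Psi>_def .
qed

section \<open>Change of variables for densities\<close>

text \<open>The known theorem concerns absolutely integrable vector-valued functions, so
  \<open>f\<close> is sent through \<open>real^1\<close> by \<open>vec\<close>. Since
  \<open>f\<close> is nonnegative and integrable, both gauge integrals are also nonnegative Lebesgue
  integrals, and the equation carries over.\<close>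

lemma nn_integral_change_of_variables:
  fixes f :: "real^'m::{finite,wellorder} \<Rightarrow> real" and g :: "real^'m::_ \<Rightarrow> real^'m::_"
  assumes S: "S \<in> sets lebesgue"
    and der: "\<And>x. x \<in> S \<Longrightarrow> (g has_derivative g' x) (at x within S)"
    and inj: "inj_on g S"
    and f: "f integrable_on g ` S" and nonneg: "\<And>y. y \<in> g ` S \<Longrightarrow> 0 \<le> f y"
  shows "(\<integral>\<^sup>+y. ennreal (f y) * indicator (g ` S) y \<partial>lborel)
       = (\<integral>\<^sup>+x. ennreal (\<bar>det (matrix (g' x))\<bar> * f (g x)) * indicator S x \<partial>lborel)"
proof -
  let ?h = "\<lambda>x. \<bar>det (matrix (g' x))\<bar> * f (g x)"
  have "f absolutely_integrable_on g ` S"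
    using f nonneg by (rule nonnegative_absolutely_integrable_1)
  then have "(\<lambda>y. vec (f y) :: real^1) absolutely_integrable_on g ` S \<and>
      integral (g ` S) (\<lambda>y. vec (f y) :: real^1) = vec (integral (g ` S) f)"
    by (simp add: absolutely_integrable_on_1_iff integral_on_1_eq)
  then have "(\<lambda>x. \<bar>det (matrix (g' x))\<bar> *\<^sub>R (vec (f (g x)) :: real^1)) absolutely_integrable_on S \<and>
      integral S (\<lambda>x. \<bar>det (matrix (g' x))\<bar> *\<^sub>R (vec (f (g x)) :: real^1)) = vec (integral (g ` S) f)"
    using has_absolute_integral_change_of_variables[OF S der inj, of "\<lambda>y. vec (f y) :: real^1"] by blast
  then have h: "?h absolutely_integrable_on S" "integral S ?h = integral (g ` S) f"
    by (simp_all add: absolutely_integrable_on_1_iff integral_on_1_eq vec_eq_iff)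
  have "(?h has_integral integral (g ` S) f) S"
    using integrable_integral[OF set_lebesgue_integral_eq_integral(1)[OF h(1)]] h(2) by simp
  then have "(\<integral>\<^sup>+x. ennreal (?h x) * indicator S x \<partial>lborel) = ennreal (integral (g ` S) f)"
    using nonneg by (intro nn_integral_has_integral_lebesgue') auto
  moreover have "(\<integral>\<^sup>+y. ennreal (f y) * indicator (g ` S) y \<partial>lborel) = ennreal (integral (g ` S) f)"
    using nonneg f by (intro nn_integral_has_integral_lebesgue' integrable_integral) auto
  ultimately show ?thesis by simp
qed

text \<open>Since \<open>g\<close> is injective, \<open>eq\<close> says that a measurable
  \<open>A \<subseteq> T\<close> has the same \<open>P\<close>-measure as its image has
  \<open>L\<close>-measure. The change of variables formula writes the latter as an integral over
  \<open>A\<close>, so the pulled-back density is a second density of \<open>P\<close>.\<close>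

lemma AE_density_change_of_variables:
  fixes T :: "(real^'k::{finite,wellorder}) set" and g :: "real^'k::_ \<Rightarrow> real^'k::_"
  assumes T: "T \<in> sets borel" and bij: "bij_betw g T T"
    and der: "\<And>x. x \<in> T \<Longrightarrow> (g has_derivative g' x) (at x)"
    and jac: "(\<lambda>x. \<bar>det (matrix (g' x))\<bar>) \<in> borel_measurable (restrict_space borel T)"
    and inv: "inv_into T g \<in> borel_measurable (restrict_space borel T)"
    and p: "p \<in> borel_measurable (restrict_space borel T)" "\<And>x. x \<in> T \<Longrightarrow> 0 \<le> p x"
    and l: "l \<in> borel_measurable (restrict_space borel T)" "\<And>x. x \<in> T \<Longrightarrow> 0 \<le> l x"
    and P: "prob_space P" "P = density (restrict_space lborel T) (\<lambda>x. ennreal (p x))"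
    and L: "prob_space L" "L = density (restrict_space lborel T) (\<lambda>x. ennreal (l x))"
    and eq: "distr P borel g = distr L borel (\<lambda>x. x)"
  shows "AE x in restrict_space lborel T. p x = \<bar>det (matrix (g' x))\<bar> * l (g x)"
proof -
  define N :: "(real^'k::_) measure" where "N = restrict_space lborel T"
  have [measurable_cong]: "sets N = sets (restrict_space borel T)"
    unfolding N_def by (intro sets_restrict_space_cong) simp
  have space [simp]: "space N = T"
    by (simp add: N_def space_restrict_space)
  define r where "r x = \<bar>det (matrix (g' x))\<bar> * l (g x)" for x
  have gT: "g x \<in> T" if "x \<in> T" for x
    using bij that by (rule bij_betwE[rule_format])
  have [measurable]: "p \<in> borel_measurable N" "l \<in> borel_measurable N"
      "(\<lambda>x. \<bar>det (matrix (g' x))\<bar>) \<in> borel_measurable N" "inv_into T g \<in> borel_measurable N"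
    using p(1) l(1) jac inv by simp_all
  have "continuous_on T g"
    using der by (meson continuous_at_imp_continuous_on has_derivative_continuous)
  then have g: "g \<in> borel_measurable (restrict_space borel T)"
    by (rule borel_measurable_continuous_on_restrict)
  then have g_borel [measurable]: "g \<in> borel_measurable N"
    by simp
  have "g \<in> restrict_space borel T \<rightarrow>\<^sub>M restrict_space borel T"
    using g gT by (intro measurable_restrict_space2) (auto simp: space_restrict_space)
  then have [measurable]: "g \<in> N \<rightarrow>\<^sub>M N"
    by simp
  have [measurable]: "r \<in> borel_measurable N"
    unfolding r_def by measurable
  have sets: "A \<in> sets borel" "A \<subseteq> T" if "A \<in> sets N" for A
    using that T by (auto simp: N_def sets_restrict_space_iff)
  have r_nonneg: "0 \<le> r x" if "x \<in> T" for x
    using l(2)[OF gT[OF that]] by (simp add: r_def)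
  have nn_N: "(\<integral>\<^sup>+x. h x * indicator A x \<partial>N) = (\<integral>\<^sup>+x. h x * indicator A x \<partial>lborel)"
    if "A \<subseteq> T" for A and h :: "real^'k::_ \<Rightarrow> ennreal"
    unfolding N_def using T that
    by (subst nn_integral_restrict_space) (auto intro!: nn_integral_cong simp: indicator_def)
  have PN: "P = density N (\<lambda>x. ennreal (p x))" and LN: "L = density N (\<lambda>x. ennreal (l x))"
    using P(2) L(2) by (simp_all add: N_def)
  have "density N p = density N r"
  proof (rule measure_eqI)
    fix A assume "A \<in> sets (density N p)"
    then have A [measurable]: "A \<in> sets N" by simp
    \<comment> \<open>Images under \<open>g\<close> are preimages under its inverse, which gives
      their measurability.\<close>
    have image: "g ` A = inv_into T g -` A \<inter> T"
      using bij sets(2)[OF A]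
      by (auto simp: bij_betw_def f_inv_into_f subset_iff intro!: rev_image_eqI)
    have image_N: "g ` A \<in> sets N"
      using measurable_sets[of "inv_into T g" N borel A] sets(1)[OF A] by (simp add: image)
    note image_sets [measurable] = sets(1)[OF image_N]
    have gA: "g -` (g ` A) \<inter> T = A"
      using bij sets(2)[OF A] by (auto simp: bij_betw_def dest: inj_onD)
    have "emeasure (density N p) A = emeasure (distr P borel g) (g ` A)"
      using gA by (simp add: PN emeasure_distr)
    also have "\<dots> = emeasure (distr L borel (\<lambda>x. x)) (g ` A)"
      by (simp add: eq)
    also have "\<dots> = emeasure L (g ` A)"
    proof -
      have "(\<lambda>x. x) \<in> borel_measurable N"
        by (simp add: N_def measurable_restrict_space1)
      then show ?thesis
        using sets(2)[OF image_N] by (simp add: LN emeasure_distr Int_absorb2)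
    qed
    finally have emeasure_A: "emeasure (density N p) A = emeasure L (g ` A)" .
    have emeasure_image: "emeasure L (g ` A) = (\<integral>\<^sup>+y. ennreal (l y) * indicator (g ` A) y \<partial>lborel)"
      unfolding LN by (simp add: emeasure_density image_N nn_N sets(2)[OF image_N])
    \<comment> \<open>The integral of \<open>l\<close> over the image is a probability, hence
      finite; this is the integrability that the change of variables formula asks for.\<close>
    have l_int: "l integrable_on g ` A"
    proof -
      have "(\<lambda>y. indicator (g ` A) y * l y) integrable_on UNIV"
      proof (rule nn_integral_integrable_on)
        have "l \<in> borel_measurable (restrict_space N (g ` A))"
          by (rule measurable_restrict_space1) simp
        also have "borel_measurable (restrict_space N (g ` A))
            = borel_measurable (restrict_space borel (g ` A))"
          by (intro measurable_cong_sets refl)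
             (simp only: N_def sets_restrict_restrict_space Int_absorb1[OF sets(2)[OF image_N]],
              simp add: sets_restrict_space)
        finally show "(\<lambda>y. indicator (g ` A) y * l y) \<in> borel_measurable borel"
          by (simp add: borel_measurable_restrict_space_iff)
        show "0 \<le> indicator (g ` A) y * l y" for y
          using l(2) sets(2)[OF image_N] by (auto simp: indicator_def)
        have "(\<integral>\<^sup>+y. ennreal (indicator (g ` A) y * l y) \<partial>lborel) = emeasure L (g ` A)"
          unfolding emeasure_image by (intro nn_integral_cong) (auto simp: indicator_def)
        also have "\<dots> < \<infinity>"
          using prob_space.emeasure_le_1[OF L(1), of "g ` A"] by (simp add: le_less_trans)
        finally show "(\<integral>\<^sup>+y. ennreal (indicator (g ` A) y * l y) \<partial>lborel) < \<infinity>" .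
      qed
      also have "(\<lambda>y. indicator (g ` A) y * l y) = (\<lambda>y. if y \<in> g ` A then l y else 0)"
        by (auto simp: indicator_def)
      finally show ?thesis
        by (simp add: integrable_restrict_UNIV)
    qed
    have "emeasure L (g ` A)
        = (\<integral>\<^sup>+x. ennreal (\<bar>det (matrix (g' x))\<bar> * l (g x)) * indicator A x \<partial>lborel)"
      unfolding emeasure_image
    proof (rule nn_integral_change_of_variables)
      show "A \<in> sets lebesgue"
        using sets(1)[OF A] by auto
      show "(g has_derivative g' x) (at x within A)" if "x \<in> A" for x
        using der sets(2)[OF A] that by (blast intro: has_derivative_at_withinI)
      show "inj_on g A"
        using bij sets(2)[OF A] by (auto simp: bij_betw_def intro: inj_on_subset)
      show "0 \<le> l y" if "y \<in> g ` A" for y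
        using l(2) sets(2)[OF image_N] that by auto
    qed (rule l_int)
    also have "\<dots> = emeasure (density N r) A"
      by (simp add: emeasure_density nn_N sets(2)[OF A] r_def)
    finally show "emeasure (density N p) A = emeasure (density N r) A"
      by (simp add: emeasure_A)
  qed simp
  \<comment> \<open>Uniqueness of densities is applied to a sigma-finite measure; here it is the
    probability measure \<open>P\<close>.\<close>
  moreover have "sigma_finite_measure (density N p)"
    using prob_space_imp_sigma_finite[OF P(1)] by (simp add: PN)
  ultimately have "AE x in N. ennreal (p x) = ennreal (r x)"
    by (subst (asm) sigma_finite_density_unique) auto
  then have "AE x in N. p x = r x"
    using AE_space by eventually_elim (use r_nonneg p(2) in simp)
  then show ?thesis
    unfolding N_def r_def .
qed

section \<open>Positive Jacobians and the comparison of the two regions\<close>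

text \<open>By the chain rule for \<open>inv_into T \<Psi> \<circ> \<Psi>\<close>, the two Jacobian
  determinants multiply to 1. Positivity is what lets the Jacobian factor cancel in the ratios of
  densities.\<close>

lemma abs_jac_pos:
  fixes \<Psi> :: "real^'k \<Rightarrow> real^'k"
  assumes T: "open T" and \<Psi>: "\<Psi> \<in> diffeos T" and \<tau>: "\<tau> \<in> T"
  shows "0 < abs_jac \<Psi> \<tau>"
proof -
  let ?J = "jacobian \<Psi> (at \<tau>)" and ?K = "jacobian (inv_into T \<Psi>) (at (\<Psi> \<tau>))"
  have bij: "bij_betw \<Psi> T T"
    using \<Psi> by (simp add: diffeos_def)
  have "\<Psi> differentiable (at \<tau>)" "inv_into T \<Psi> differentiable (at (\<Psi> \<tau>))"
    using \<Psi> \<tau> bij by (auto simp: diffeos_def continuously_differentiable_on_def bij_betw_def)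
  then have "(\<Psi> has_derivative (\<lambda>h. ?J *v h)) (at \<tau>)"
    and "(inv_into T \<Psi> has_derivative (\<lambda>h. ?K *v h)) (at (\<Psi> \<tau>))"
    by (simp_all add: jacobian_works)
  then have "(inv_into T \<Psi> \<circ> \<Psi> has_derivative (\<lambda>h. ?K *v h) \<circ> (\<lambda>h. ?J *v h)) (at \<tau>)"
    by (rule diff_chain_at)
  \<comment> \<open>The composition is known to be the identity only on \<open>T\<close>; since
    \<open>T\<close> is open, this fixes the derivative at \<open>\<tau>\<close>.\<close>
  then have "((\<lambda>x. x) has_derivative (\<lambda>h. ?K *v h) \<circ> (\<lambda>h. ?J *v h)) (at \<tau>)"
    by (rule has_derivative_transform_within_open[OF _ T \<tau>])
       (use bij in \<open>auto simp: bij_betw_def\<close>)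
  then have "(\<lambda>h. ?K *v h) \<circ> (\<lambda>h. ?J *v h) = (\<lambda>h. h)"
    using has_derivative_unique has_derivative_ident by blast
  then have "(?K ** ?J) *v h = mat 1 *v h" for h
    by (simp add: o_def fun_eq_iff matrix_vector_mul_assoc)
  then have "?K ** ?J = mat 1"
    by (simp add: matrix_eq)
  then have "det ?K * det ?J = 1"
    by (metis det_I det_mul)
  then show ?thesis
    by (auto simp: abs_jac_def)
qed

theorem lemma11:
  fixes M :: "'x measure" and f :: "'t \<Rightarrow> 'x \<Rightarrow> real" and Pr :: "'t measure"
    and T :: "(real^'k::{finite,wellorder}) set" and Ups :: "'t \<Rightarrow> real^'k::_"
    and \<Lambda> :: "(real^'k::_) measure"
    and prior_dens post_dens \<Lambda>dens :: "real^'k::_ \<Rightarrow> real"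
    and \<Psi>\<^sub>\<Lambda> \<Psi>\<^sub>\<Pi> :: "real^'k::_ \<Rightarrow> real^'k::_"
    and \<gamma> :: real and x :: 'x
  assumes model: "bayesian_model M f Pr"
    and T: "open T"
    and Ups: "Ups \<in> measurable Pr (restrict_space borel T)"
    and \<gamma>: "0 \<le> \<gamma>" "\<gamma> \<le> 1"
    and x: "x \<in> space M"
    and prior_density: "is_density (volume_on T) (marginal_on T Ups Pr) prior_dens"
    and posterior_density:
      "is_density (volume_on T) (marginal_on T Ups (posterior f Pr x)) post_dens"
    and \<Lambda>: "prob_space \<Lambda>" "is_density (volume_on T) \<Lambda> \<Lambda>dens"
    and \<Psi>\<Lambda>: "uniformizing T \<Lambda> \<Psi>\<^sub>\<Lambda>"
    and \<Psi>\<Pi>: "uniformizing T (marginal_on T Ups Pr) \<Psi>\<^sub>\<Pi>"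
    and diffeo: "inv_into T \<Psi>\<^sub>\<Lambda> \<circ> \<Psi>\<^sub>\<Pi> \<in> diffeos T"
  shows "mem_mod_null (volume_on T)
    (relative_surprise_region T (marginal_on T Ups (posterior f Pr x)) post_dens prior_dens \<gamma>)
    (B_class T (marginal_on T Ups (posterior f Pr x)) post_dens \<Lambda>dens \<gamma>)"
proof -
  define N :: "(real^'k::_) measure" where "N = restrict_space lborel T"
  define P Q where "P = marginal_on T Ups Pr" and "Q = marginal_on T Ups (posterior f Pr x)"
  define \<Psi> where "\<Psi> = inv_into T \<Psi>\<^sub>\<Lambda> \<circ> \<Psi>\<^sub>\<Pi>"
  define \<rho> \<sigma> where "\<rho> \<tau> = ennreal (post_dens \<tau>) / ennreal (prior_dens \<tau>)"
    and "\<sigma> \<tau> = ennreal (post_dens \<tau> * (1 / abs_jac \<Psi> \<tau>)) / ennreal (\<Lambda>dens (\<Psi> \<tau>))" for \<tau>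
  have Tb: "T \<in> sets borel"
    using T by simp
  have sets_N [measurable_cong]: "sets N = sets (restrict_space borel T)"
    unfolding N_def by (intro sets_restrict_space_cong) simp
  have space_N [simp]: "space N = T"
    by (simp add: N_def space_restrict_space)
  have vol: "volume_on T = N"
    by (simp add: volume_on_def N_def)
  have [measurable]: "prior_dens \<in> borel_measurable N" "post_dens \<in> borel_measurable N"
      "\<Lambda>dens \<in> borel_measurable N"
    and nonneg: "\<And>\<tau>. \<tau> \<in> T \<Longrightarrow> 0 \<le> prior_dens \<tau>" "\<And>\<tau>. \<tau> \<in> T \<Longrightarrow> 0 \<le> post_dens \<tau>"
      "\<And>\<tau>. \<tau> \<in> T \<Longrightarrow> 0 \<le> \<Lambda>dens \<tau>"
    and dens: "P = density N prior_dens" "Q = density N post_dens" "\<Lambda> = density N \<Lambda>dens"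
    using prior_density posterior_density \<Lambda>(2) by (simp_all add: is_density_def vol P_def Q_def)
  \<comment> \<open>Lebesgue measure has no point masses, so measures with a density with respect to
    \<open>N\<close> have none; \<open>distr_inv_into_eq\<close> asks this of \<open>P\<close> and
    \<open>\<Lambda>\<close>.\<close>
  have N_neq: "AE \<tau> in N. \<tau> \<noteq> a" for a
    unfolding N_def using Tb AE_lborel_singleton[of a] by (subst AE_restrict_space_iff) auto
  have AE_neq: "AE \<tau> in density N h. \<tau> \<noteq> a" if "h \<in> borel_measurable N" for h a
    using that N_neq[of a] by (subst AE_density) (auto elim: eventually_mono)
  have \<Psi>: "\<Psi> \<in> diffeos T"
    using diffeo by (simp add: \<Psi>_def)
  then have bij: "bij_betw \<Psi> T T"
    and der: "\<tau> \<in> T \<Longrightarrow> (\<Psi> has_derivative (\<lambda>h. jacobian \<Psi> (at \<tau>) *v h)) (at \<tau>)"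
    and inv_diff: "\<tau> \<in> T \<Longrightarrow> inv_into T \<Psi> differentiable (at \<tau>)"
    and cont_jac: "continuous_on T (\<lambda>\<tau>. jacobian \<Psi> (at \<tau>))" for \<tau>
    by (simp_all add: diffeos_def continuously_differentiable_on_def jacobian_works)
  have cont: "continuous_on T \<Psi>" and cont_inv: "continuous_on T (inv_into T \<Psi>)"
    using der inv_diff
    by (meson continuous_at_imp_continuous_on has_derivative_continuous
        differentiable_imp_continuous_within)+
  \<comment> \<open>Unfolded, \<open>det\<close> is a polynomial in the matrix entries, which depend
    continuously on the point.\<close>
  have "continuous_on T (abs_jac \<Psi>)"
    unfolding abs_jac_def [abs_def] det_def using cont_jac
    by (intro continuous_intros continuous_on_compose2[OF _ continuous_on_component]) auto
  with cont cont_inv have meas: "\<Psi> \<in> borel_measurable (restrict_space borel T)"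
      "inv_into T \<Psi> \<in> borel_measurable (restrict_space borel T)"
      "abs_jac \<Psi> \<in> borel_measurable (restrict_space borel T)"
    by (auto intro: borel_measurable_continuous_on_restrict)
  then have "\<Psi> \<in> restrict_space borel T \<rightarrow>\<^sub>M restrict_space borel T"
    using bij by (intro measurable_restrict_space2) (auto simp: bij_betw_def space_restrict_space)
  with meas have [measurable]: "\<Psi> \<in> N \<rightarrow>\<^sub>M N" "abs_jac \<Psi> \<in> borel_measurable N"
    by simp_all
  have "prob_space Pr"
    using model by (simp add: bayesian_model_def)
  then have P: "prob_space P"
    unfolding P_def marginal_on_def using Ups by (rule prob_space.prob_space_distr)
  \<comment> \<open>The common image of \<open>P\<close> under \<open>\<Psi>\<^sub>\<Pi>\<close> and
    of \<open>\<Lambda>\<close> under \<open>\<Psi>\<^sub>\<Lambda>\<close> is the uniform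
    distribution on the unit cube.\<close>
  have transport: "distr P borel \<Psi> = distr \<Lambda> borel (\<lambda>\<tau>. \<tau>)"
    unfolding \<Psi>_def
  proof (rule distr_inv_into_eq[OF Tb P _ _ \<Lambda>(1)])
    show "sets P = sets (restrict_space borel T)" "sets \<Lambda> = sets (restrict_space borel T)"
      by (simp_all add: dens sets_N)
    show "AE \<tau> in P. \<tau> \<noteq> a" "AE \<tau> in \<Lambda>. \<tau> \<noteq> a" for a
      unfolding dens by (rule AE_neq, simp)+
  qed (use \<Psi>\<Lambda> \<Psi>\<Pi> bij meas in \<open>simp_all add: uniformizing_def P_def flip: \<Psi>_def\<close>)
  have "AE \<tau> in restrict_space lborel T. prior_dens \<tau>
      = \<bar>det (matrix (\<lambda>h. jacobian \<Psi> (at \<tau>) *v h))\<bar> * \<Lambda>dens (\<Psi> \<tau>)"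
  proof (rule AE_density_change_of_variables[OF Tb bij der])
    show "(\<lambda>\<tau>. \<bar>det (matrix (\<lambda>h. jacobian \<Psi> (at \<tau>) *v h))\<bar>)
        \<in> borel_measurable (restrict_space borel T)"
      using meas(3) by (simp add: abs_jac_def [abs_def])
    show "prior_dens \<in> borel_measurable (restrict_space borel T)"
        "\<Lambda>dens \<in> borel_measurable (restrict_space borel T)"
      by measurable
    show "P = density (restrict_space lborel T) prior_dens"
        "\<Lambda> = density (restrict_space lborel T) \<Lambda>dens"
      using dens by (simp_all only: N_def)
  qed (use meas(2) nonneg P \<Lambda>(1) transport in auto)
  then have prior: "AE \<tau> in N. prior_dens \<tau> = abs_jac \<Psi> \<tau> * \<Lambda>dens (\<Psi> \<tau>)"
    unfolding N_def abs_jac_def by simp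
  have ratio: "AE \<tau> in N. \<rho> \<tau> = \<sigma> \<tau>"
    using prior AE_space
  proof eventually_elim
    case (elim \<tau>)
    then have \<tau>: "\<tau> \<in> T" "\<Psi> \<tau> \<in> T"
      using bij by (auto simp: bij_betw_def)
    then have "0 < abs_jac \<Psi> \<tau>" "0 \<le> post_dens \<tau>" "0 \<le> \<Lambda>dens (\<Psi> \<tau>)"
      using abs_jac_pos[OF T \<Psi>] nonneg by auto
    then show ?case
      \<comment> \<open>Where \<open>\<Lambda>dens (\<Psi> \<tau>)\<close> is positive, the Jacobian
        merely moves from one side of the fraction to the other. Where it is 0, both ratios are
        \<infinity> if \<open>post_dens \<tau>\<close> is positive and 0 otherwise.\<close>
      unfolding \<rho>_def \<sigma>_def elim
      by (cases "\<Lambda>dens (\<Psi> \<tau>) = 0"; cases "post_dens \<tau> = 0")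
         (auto simp: divide_ennreal ennreal_divide_zero ennreal_zero_divide)
  qed
  have [measurable]: "\<rho> \<in> borel_measurable N" "\<sigma> \<in> borel_measurable N"
    unfolding \<rho>_def \<sigma>_def by measurable
  \<comment> \<open>For each threshold the superlevel sets differ by an \<open>N\<close>-null set,
    which is also null for \<open>Q\<close> because \<open>Q\<close> has a density with respect to
    \<open>N\<close>.\<close>
  have level: "measure Q {\<tau> \<in> T. t < \<rho> \<tau>} = measure Q {\<tau> \<in> T. t < \<sigma> \<tau>}" for t
  proof (rule measure_eq_AE)
    show "AE \<tau> in Q. \<tau> \<in> {\<tau> \<in> T. t < \<rho> \<tau>} \<longleftrightarrow> \<tau> \<in> {\<tau> \<in> T. t < \<sigma> \<tau>}"
      unfolding dens using ratio by (subst AE_density) (auto elim: eventually_mono)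
    have "{\<tau> \<in> space N. t < \<rho> \<tau>} \<in> sets N" "{\<tau> \<in> space N. t < \<sigma> \<tau>} \<in> sets N"
      by measurable
    then show "{\<tau> \<in> T. t < \<rho> \<tau>} \<in> sets Q" "{\<tau> \<in> T. t < \<sigma> \<tau>} \<in> sets Q"
      unfolding dens sets_density space_N .
  qed
  have C: "relative_surprise_region T Q post_dens prior_dens \<gamma>
      = {\<tau> \<in> T. measure Q {\<tau>' \<in> T. \<rho> \<tau> < \<rho> \<tau>'} \<le> \<gamma>}"
    by (simp add: relative_surprise_region_def \<rho>_def)
  \<comment> \<open>At \<open>\<psi>0 = \<Psi> \<tau>\<close> the inverse returns
    \<open>\<tau>\<close>, so the threshold in \<open>B_region\<close> becomes
    \<open>\<sigma> \<tau>\<close>.\<close>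
  have B: "\<Psi> -` B_region T Q post_dens \<Lambda>dens \<gamma> \<Psi> \<inter> T
      = {\<tau> \<in> T. measure Q {\<tau>' \<in> T. \<sigma> \<tau> < \<sigma> \<tau>'} \<le> \<gamma>}"
    using bij by (auto simp: B_region_def \<sigma>_def bij_betw_def)
  \<comment> \<open>The regions can disagree only where \<open>\<rho> \<tau>\<close> and
    \<open>\<sigma> \<tau>\<close> differ; elsewhere \<open>level\<close> applies with their common
    value as threshold.\<close>
  have "AE \<tau> in N. \<tau> \<in> relative_surprise_region T Q post_dens prior_dens \<gamma>
      \<longleftrightarrow> \<tau> \<in> \<Psi> -` B_region T Q post_dens \<Lambda>dens \<gamma> \<Psi> \<inter> T"
    unfolding B C using ratio by eventually_elim (simp add: level)
  then show ?thesis
    using \<Psi> unfolding mem_mod_null_def B_class_def Q_def vol by blast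
qed

end
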